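(* Let $\mathit{TS}=\langle \mathit{Init},\mathit{Tr},X\rangle$ be a transition system with sink formula $\mathit{Sink}(X)\leftrightarrow\lnot\exists X'.\,\mathit{Tr}(X,X')$. If the procedure $\mathsf{ExtAnalyze}$ (defined in the context), run on the input $P=\langle \mathit{Init},\mathit{Tr},\mathit{Sink},X\rangle$, returns NONTERM, then the original transition system $\langle \mathit{Init},\mathit{Tr},X\rangle$ is nonterminating.
   Context: **Setting.** Formulas are over Linear Integer Arithmetic. $X$ is a finite set of state variables, $X'$ its primed (next-state) copy, $X'',X^{(0)},X^{(1)},\dots$ further copies. A state is an integer valuation of $X$. State formulas are over $X$; transition formulas are over $X\cup X'$. $\mathit{Id}(X,X')$ is $\bigwedge_{x\in X}x=x'$. A transition system is $\langle \mathit{Init},\mathit{Tr},X\rangle$ with $\mathit{Init}$ a state formula and $\mathit{Tr}$ a transition formula. $\mathit{Tr}^n(X^{(0)},\dots,X^{(n)})=\mathit{Tr}(X^{(0)},X^{(1)})\land\dots\land\mathit{Tr}(X^{(n-1)},X^{(n)})$; for $n=0$ the first and last copies are identified, i.e. $\mathit{Tr}^0(X,X')$ is $\mathit{Id}(X,X')$. The system is nonterminating if there is an initial state from which any number of transitions can be taken: there is a state $X$ with $\mathit{Init}(X)$ such that $\forall n\in\mathbb N.\ \exists X^{(1)},\dots,X^{(n)}.\ \mathit{Tr}^n(X,X^{(1)},\dots,X^{(n)})$. **Subroutines (any implementation meeting these specifications).** - $\mathsf{QE}$ returns a quantifier-free equivalent formula. - $\mathsf{SafetyCheck}(\langle I,T,B,X\rangle)$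 returns either $\langle\mathrm{SAFE},\mathit{Inv}\rangle$ with $I\to\mathit{Inv}$, $\mathit{Inv}(X)\land T(X,X')\to\mathit{Inv}(X')$, $\mathit{Inv}\to\lnot B$; or $\langle\mathrm{UNSAFE},T^n\rangle$ for some $n\ge 0$ such that $I(X^{(0)})\land T^n(X^{(0)},\dots,X^{(n)})\land B(X^{(n)})$ is satisfiable. - $\mathsf{Itp}(A,B)$, for unsatisfiable $A\land B$, returns a Craig interpolant: a formula $J$ with $A\to J$, $J\land B$ unsatisfiable, and $J$ using only symbols common to $A$ and $B$. - $\mathsf{ToDNF}(J)$ returns a finite disjunction of conjunctions of literals that implies $J$. **$\mathsf{BlockTerm}(\langle I,T,B,X\rangle,T^n)$.** For $0\le i\le n$ let $S_i(X)$ be the formula obtained from $I(X^{(0)})\land T^n(X^{(0)},\dots,X^{(n)})\land B(X^{(n)})$ by existentially eliminating all copies except $X^{(i)}$ and renaming $X^{(i)}$ to $X$. For $i=n-1,n-2,\dots,0$ in this order: if $S_i(X)\land T(X,X')\land\lnot S_{i+1}(X')$ is satisfiable, return $\langle I,\;T(X,X')\land\lnot S_{i+1}(X'),\;B,\;X\rangle$. If this never happens, return $\langle I\land\lnot S_0,\;T,\;B,\;X\rangle$. **$\mathsf{TrInvGen}(\langle I,T,B,X\rangle,T^n,\mathit{TrInv})$.** (1) $\mathit{NT}^n(X^{(0)}):=\mathsf{QE}(\exists X^{(1)},\dots,X^{(n)}.\,T^n(X^{(0)},\dots,X^{(n)})\land\lnot B(X^{(n)}))$. (2) $\mathit{itp}(X,X'):=\mathsf{Itp}\big(T^n(X,\dots,X'),\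 \lnot\mathit{NT}^n(X)\land\lnot B(X')\big)$. (3) $\mathit{Cs}:=\mathsf{ToDNF}(\mathit{itp})$. (4) $\mathit{TrInv}:=\mathit{TrInv}\lor\bigvee\{d\text{ a disjunct of }\mathit{Cs}\mid d\text{ admits a ranking function}\}$, where a ranking function for $d(X,X')$ is a (linear) function $f$ of the state witnessing that $d$ is well-founded (has no infinite chain): on $d$, $f(X)>f(X')$ in a well-founded order (e.g. integer-valued and bounded below on $d$). (5) $C(X):=B(X)\lor\lnot\mathsf{QE}\big(\exists X',X''.\,T(X,X')\land(\mathit{Id}(X',X'')\lor\mathit{TrInv}(X',X''))\land\lnot\mathit{TrInv}(X,X'')\big)$. Return $\langle\mathit{TrInv},C\rangle$. **$\mathsf{ExtAnalyze}(P)$.** Initialize $\mathit{TrInv}:=\bot$ and a stack $\mathit{Prs}:=[P]$. Repeat: pop $P'=\langle I,T,B,X\rangle$ from $\mathit{Prs}$ and compute $\langle\mathit{res},\phi\rangle:=\mathsf{SafetyCheck}(P')$. - If $\mathit{res}=\mathrm{UNSAFE}$: set $\langle\mathit{TrInv},C\rangle:=\mathsf{TrInvGen}(P',\phi,\mathit{TrInv})$ and $\langle\mathit{res}',\phi'\rangle:=\mathsf{SafetyCheck}(\langle I,T,\lnot C,X\rangle)$. If $\mathit{res}'=\mathrm{UNSAFE}$ with $\phi'=T^m$: push $\mathsf{BlockTerm}(P',\phi)$; then compute $S_m(X):=\mathsf{QE}(\exists X^{(0)},\dots,X^{(m-1)}.\,I(X^{(0)})\land\phi'(X^{(0)},\dots,X^{(m)})\land\lnot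 C(X^{(m)}))[X^{(m)}\mapsto X]$ and push $\langle S_m,T,C,X\rangle$ on top. If $\mathit{res}'=\mathrm{SAFE}$: if $\mathit{Prs}$ is empty return TERM, else continue with the next iteration. - If $\mathit{res}=\mathrm{SAFE}$: if $\forall X.\,\phi(X)\to\exists X'.\,T(X,X')\land\phi(X')$, return NONTERM. Otherwise, if $I(X)\land T(X,X')$ is unsatisfiable: return TERM if $\mathit{Prs}$ is empty, else continue with the next iteration. Otherwise push $\langle I,T,\lnot\mathsf{QE}(\exists X'.\,T(X,X')),X\rangle$. The procedure need not halt; the claim concerns runs that return NONTERM.
   Formalization: The formal theorem adds that the initial formula I of the problem popped in the iteration returning NONTERM is satisfiable; otherwise SafetyCheck may answer SAFE with Inv = false and NONTERM is returned vacuously (e.g. Init = false), so the claim as stated fails. *)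

theory Defs
  imports Main
begin

(* Linear integer arithmetic. The type variable 'a ranges over the free variables. Quantified
   variables (Bnd) live in a namespace of their own, so set_fm yields the free variables of a
   formula and map_fm renames them without capture. Divisibility by constants is needed for
   quantifier elimination. *)

datatype 'a tm =
    Cst int
  | Var 'a
  | Bnd nat
  | Add "'a tm" "'a tm"
  | Mul int "'a tm"

datatype 'a fm =
    TT
  | FF
  | Eq "'a tm" "'a tm"
  | Le "'a tm" "'a tm"
  | Dvd int "'a tm"
  | Neg "'a fm"
  | And "'a fm" "'a fm"
  | Or "'a fm" "'a fm"
  | Ex nat "'a fm"

primrec tval :: "('a \<Rightarrow> int) \<Rightarrow> (nat \<Rightarrow> int) \<Rightarrow> 'a tm \<Rightarrow> int" where
  "tval \<sigma> \<beta> (Cst c) = c"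
| "tval \<sigma> \<beta> (Var v) = \<sigma> v"
| "tval \<sigma> \<beta> (Bnd b) = \<beta> b"
| "tval \<sigma> \<beta> (Add s t) = tval \<sigma> \<beta> s + tval \<sigma> \<beta> t"
| "tval \<sigma> \<beta> (Mul c t) = c * tval \<sigma> \<beta> t"

primrec fval :: "('a \<Rightarrow> int) \<Rightarrow> (nat \<Rightarrow> int) \<Rightarrow> 'a fm \<Rightarrow> bool" where
  "fval \<sigma> \<beta> TT \<longleftrightarrow> True"
| "fval \<sigma> \<beta> FF \<longleftrightarrow> False"
| "fval \<sigma> \<beta> (Eq s t) \<longleftrightarrow> tval \<sigma> \<beta> s = tval \<sigma> \<beta> t"
| "fval \<sigma> \<beta> (Le s t) \<longleftrightarrow> tval \<sigma> \<beta> s \<le> tval \<sigma> \<beta> t"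
| "fval \<sigma> \<beta> (Dvd d t) \<longleftrightarrow> d dvd tval \<sigma> \<beta> t"
| "fval \<sigma> \<beta> (Neg \<phi>) \<longleftrightarrow> \<not> fval \<sigma> \<beta> \<phi>"
| "fval \<sigma> \<beta> (And \<phi> \<psi>) \<longleftrightarrow> fval \<sigma> \<beta> \<phi> \<and> fval \<sigma> \<beta> \<psi>"
| "fval \<sigma> \<beta> (Or \<phi> \<psi>) \<longleftrightarrow> fval \<sigma> \<beta> \<phi> \<or> fval \<sigma> \<beta> \<psi>"
| "fval \<sigma> \<beta> (Ex b \<phi>) \<longleftrightarrow> (\<exists>z. fval \<sigma> (\<beta>(b := z)) \<phi>)"

(* The start value of the bound variables is immaterial unless some Bnd b occurs outside the
   scope of Ex b; such an occurrence denotes the constant 0. *)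
definition sem :: "('a \<Rightarrow> int) \<Rightarrow> 'a fm \<Rightarrow> bool" where
  "sem \<sigma> \<phi> \<longleftrightarrow> fval \<sigma> (\<lambda>_. 0) \<phi>"

definition satisfiable :: "'a fm \<Rightarrow> bool" where
  "satisfiable \<phi> \<longleftrightarrow> (\<exists>\<sigma>. sem \<sigma> \<phi>)"

definition entails :: "'a fm \<Rightarrow> 'a fm \<Rightarrow> bool" where
  "entails \<phi> \<psi> \<longleftrightarrow> (\<forall>\<sigma>. sem \<sigma> \<phi> \<longrightarrow> sem \<sigma> \<psi>)"

fun qfree :: "'a fm \<Rightarrow> bool" where
  "qfree (Neg \<phi>) \<longleftrightarrow> qfree \<phi>"
| "qfree (And \<phi> \<psi>) \<longleftrightarrow> qfree \<phi> \<and> qfree \<psi>"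
| "qfree (Or \<phi> \<psi>) \<longleftrightarrow> qfree \<phi> \<and> qfree \<psi>"
| "qfree (Ex b \<phi>) \<longleftrightarrow> False"
| "qfree _ \<longleftrightarrow> True"

fun is_atom :: "'a fm \<Rightarrow> bool" where
  "is_atom (Eq s t) \<longleftrightarrow> True"
| "is_atom (Le s t) \<longleftrightarrow> True"
| "is_atom (Dvd d t) \<longleftrightarrow> True"
| "is_atom _ \<longleftrightarrow> False"

fun is_literal :: "'a fm \<Rightarrow> bool" where
  "is_literal (Neg \<phi>) \<longleftrightarrow> is_atom \<phi>"
| "is_literal \<phi> \<longleftrightarrow> is_atom \<phi>"

definition conj_fm :: "'a fm list \<Rightarrow> 'a fm" where
  "conj_fm \<phi>s = foldr And \<phi>s TT"

definition disj_fm :: "'a fm list \<Rightarrow> 'a fm" where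
  "disj_fm \<phi>s = foldr Or \<phi>s FF"

(* The variable (x, k) is the copy of x in X^(k): (x, 0) is x and (x, 1) is x'. *)

type_synonym 'v cfm = "('v \<times> nat) fm"

definition state_fm :: "'v set \<Rightarrow> 'v cfm \<Rightarrow> bool" where
  "state_fm X \<phi> \<longleftrightarrow> set_fm \<phi> \<subseteq> X \<times> {0}"

definition trans_fm :: "'v set \<Rightarrow> 'v cfm \<Rightarrow> bool" where
  "trans_fm X \<phi> \<longleftrightarrow> set_fm \<phi> \<subseteq> X \<times> {0, 1}"

(* For formulas over one copy of X: the same formula over X^(k). *)
definition at :: "nat \<Rightarrow> 'v cfm \<Rightarrow> 'v cfm" where
  "at k \<phi> = map_fm (\<lambda>(x, j). (x, k)) \<phi>"

(* For transition formulas: \<phi>(X^(k), X^(l)). *)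
definition between :: "nat \<Rightarrow> nat \<Rightarrow> 'v cfm \<Rightarrow> 'v cfm" where
  "between k l \<phi> = map_fm (\<lambda>(x, j). (x, if j = 0 then k else l)) \<phi>"

definition id_fm :: "'v::linorder set \<Rightarrow> nat \<Rightarrow> nat \<Rightarrow> 'v cfm" where
  "id_fm X k l = conj_fm (map (\<lambda>x. Eq (Var (x, k)) (Var (x, l))) (sorted_list_of_set X))"

(* chain T [k0, ..., kn] is T(X^(k0), X^(k1)) \<and> ... \<and> T(X^(k(n-1)), X^(kn)). *)
fun chain :: "'v cfm \<Rightarrow> nat list \<Rightarrow> 'v cfm" where
  "chain T (k # l # ks) = And (between k l T) (chain T (l # ks))"
| "chain T _ = TT"

(* T^n(X^(0), ..., X^(n)) *)
definition unroll :: "'v cfm \<Rightarrow> nat \<Rightarrow> 'v cfm" where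
  "unroll T n = chain T [0..<Suc n]"

(* T^n(X, ..., X'), with copies 2, ..., n in the intermediate positions *)
definition unroll_ends :: "'v::linorder set \<Rightarrow> 'v cfm \<Rightarrow> nat \<Rightarrow> 'v cfm" where
  "unroll_ends X T n = (if n = 0 then id_fm X 0 1 else chain T (0 # [2..<Suc n] @ [1]))"

(* States are total valuations; their values outside X are irrelevant for formulas over X. *)

type_synonym 'v state = "'v \<Rightarrow> int"

definition holds :: "'v cfm \<Rightarrow> 'v state \<Rightarrow> bool" where
  "holds \<phi> s \<longleftrightarrow> sem (\<lambda>(x, k). s x) \<phi>"

definition holds2 :: "'v cfm \<Rightarrow> 'v state \<Rightarrow> 'v state \<Rightarrow> bool" where
  "holds2 \<phi> s s' \<longleftrightarrow> sem (\<lambda>(x, k). if k = 0 then s x else s' x) \<phi>"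

definition nonterminating :: "'v cfm \<Rightarrow> 'v cfm \<Rightarrow> bool" where
  "nonterminating Init Tr \<longleftrightarrow>
     (\<exists>s. holds Init s \<and>
       (\<forall>n. \<exists>p :: nat \<Rightarrow> 'v state. p 0 = s \<and> (\<forall>i<n. holds2 Tr (p i) (p (Suc i)))))"

(* The tuple <I, T, B, X>; the set X never changes during a run and is passed separately. *)
datatype 'v problem = Problem (ini: "'v cfm") (tra: "'v cfm") (bad: "'v cfm")

(* The subroutines are input-output relations: any result meeting the specification may be
   returned, and a call need not have a result (there is no total SafetyCheck, since safe
   systems need not have an inductive invariant expressible in the logic). *)

(* \<psi> is a possible result of QE(\<exists>V. \<phi>). *)
definition qe :: "'a set \<Rightarrow> 'a fm \<Rightarrow> 'a fm \<Rightarrow> bool" where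
  "qe V \<phi> \<psi> \<longleftrightarrow> qfree \<psi> \<and> set_fm \<psi> \<subseteq> set_fm \<phi> - V \<and>
     (\<forall>\<sigma>. sem \<sigma> \<psi> \<longleftrightarrow> (\<exists>\<tau>. (\<forall>v. v \<notin> V \<longrightarrow> \<tau> v = \<sigma> v) \<and> sem \<tau> \<phi>))"

(* UNSAFE n stands for the answer <UNSAFE, T^n>. *)
datatype 'v verdict = SAFE "'v cfm" | UNSAFE nat

fun safety_check :: "'v set \<Rightarrow> 'v problem \<Rightarrow> 'v verdict \<Rightarrow> bool" where
  "safety_check X (Problem I T B) (SAFE Inv) \<longleftrightarrow>
     state_fm X Inv \<and> entails I Inv \<and> entails (And Inv T) (at 1 Inv) \<and> entails Inv (Neg B)"
| "safety_check X (Problem I T B) (UNSAFE n) \<longleftrightarrow>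
     satisfiable (And I (And (unroll T n) (at n B)))"

definition craig_itp :: "'a fm \<Rightarrow> 'a fm \<Rightarrow> 'a fm \<Rightarrow> bool" where
  "craig_itp A B J \<longleftrightarrow> \<not> satisfiable (And A B) \<and>
     entails A J \<and> \<not> satisfiable (And J B) \<and> set_fm J \<subseteq> set_fm A \<inter> set_fm B"

definition dnf_fm :: "'a fm list list \<Rightarrow> 'a fm" where
  "dnf_fm cs = disj_fm (map conj_fm cs)"

definition to_dnf :: "'v set \<Rightarrow> 'v cfm \<Rightarrow> 'v cfm list list \<Rightarrow> bool" where
  "to_dnf X J cs \<longleftrightarrow>
     (\<forall>c\<in>set cs. \<forall>l\<in>set c. is_literal l \<and> trans_fm X l) \<and> entails (dnf_fm cs) J"

definition linear_fun :: "'v set \<Rightarrow> ('v \<Rightarrow> int) \<Rightarrow> int \<Rightarrow> 'v state \<Rightarrow> int" where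
  "linear_fun X a c s = (\<Sum>x\<in>X. a x * s x) + c"

definition admits_ranking :: "'v set \<Rightarrow> 'v cfm \<Rightarrow> bool" where
  "admits_ranking X d \<longleftrightarrow>
     (\<exists>a c b. \<forall>s s'. holds2 d s s' \<longrightarrow>
        linear_fun X a c s > linear_fun X a c s' \<and> linear_fun X a c s \<ge> b)"

(* block_scan P S n is the loop of BlockTerm over the indices n-1, ..., 0. *)
fun block_scan :: "'v problem \<Rightarrow> (nat \<Rightarrow> 'v cfm) \<Rightarrow> nat \<Rightarrow> 'v problem" where
  "block_scan (Problem I T B) S 0 = Problem (And I (Neg (S 0))) T B"
| "block_scan (Problem I T B) S (Suc i) =
     (if satisfiable (And (S i) (And T (Neg (at 1 (S (Suc i))))))
      then Problem I (And T (Neg (at 1 (S (Suc i))))) B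
      else block_scan (Problem I T B) S i)"

definition block_term :: "'v set \<Rightarrow> 'v problem \<Rightarrow> nat \<Rightarrow> 'v problem \<Rightarrow> bool" where
  "block_term X P n Q \<longleftrightarrow>
     (\<exists>S. (\<forall>i\<le>n. \<exists>E. qe (X \<times> ({0..n} - {i}))
                        (And (ini P) (And (unroll (tra P) n) (at n (bad P)))) E \<and>
                     S i = at 0 E) \<and>
          Q = block_scan P S n)"

definition tr_inv_gen ::
  "'v::linorder set \<Rightarrow> 'v problem \<Rightarrow> nat \<Rightarrow> 'v cfm \<Rightarrow> 'v cfm \<Rightarrow> 'v cfm \<Rightarrow> bool" where
  "tr_inv_gen X P n TrInv TrInv' C \<longleftrightarrow>
     (\<exists>NT itp Cs Q.
        qe (X \<times> {1..n}) (And (unroll (tra P) n) (Neg (at n (bad P)))) NT \<and>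
        craig_itp (unroll_ends X (tra P) n) (And (Neg NT) (Neg (at 1 (bad P)))) itp \<and>
        to_dnf X itp Cs \<and>
        TrInv' = Or TrInv (disj_fm (filter (admits_ranking X) (map conj_fm Cs))) \<and>
        qe (X \<times> {1, 2})
           (And (tra P)
             (And (Or (id_fm X 1 2) (between 1 2 TrInv')) (Neg (between 0 2 TrInv')))) Q \<and>
        C = Or (bad P) (Neg Q))"

datatype 'v config =
    Running (trinv: "'v cfm") (stack: "'v problem list")
  | Ret_TERM
  | Ret_NONTERM

(* One iteration of the main loop. If I is unsatisfiable, Inv = FF passes both SafetyCheck and the
   test of safe_nonterm, so Ret_NONTERM is informative only for a popped problem whose I is
   satisfiable. BlockTerm can push problems with unsatisfiable I even if Init is satisfiable. *)
inductive ext_step :: "'v::linorder set \<Rightarrow> 'v config \<Rightarrow> 'v config \<Rightarrow> bool" for X where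
  unsafe_unsafe:
    "\<lbrakk>safety_check X (Problem I T B) (UNSAFE n);
      tr_inv_gen X (Problem I T B) n TrInv TrInv' C;
      safety_check X (Problem I T (Neg C)) (UNSAFE m);
      block_term X (Problem I T B) n Q;
      qe (X \<times> {0..<m}) (And I (And (unroll T m) (Neg (at m C)))) S\<rbrakk>
     \<Longrightarrow> ext_step X (Running TrInv (Problem I T B # Prs))
                    (Running TrInv' (Problem (at 0 S) T C # Q # Prs))"
| unsafe_safe_term:
    "\<lbrakk>safety_check X (Problem I T B) (UNSAFE n);
      tr_inv_gen X (Problem I T B) n TrInv TrInv' C;
      safety_check X (Problem I T (Neg C)) (SAFE Inv)\<rbrakk>
     \<Longrightarrow> ext_step X (Running TrInv [Problem I T B]) Ret_TERM"
| unsafe_safe_continue: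
    "\<lbrakk>safety_check X (Problem I T B) (UNSAFE n);
      tr_inv_gen X (Problem I T B) n TrInv TrInv' C;
      safety_check X (Problem I T (Neg C)) (SAFE Inv);
      Prs \<noteq> []\<rbrakk>
     \<Longrightarrow> ext_step X (Running TrInv (Problem I T B # Prs)) (Running TrInv' Prs)"
| safe_nonterm:
    "\<lbrakk>safety_check X (Problem I T B) (SAFE Inv);
      \<forall>s. holds Inv s \<longrightarrow> (\<exists>s'. holds2 T s s' \<and> holds Inv s')\<rbrakk>
     \<Longrightarrow> ext_step X (Running TrInv (Problem I T B # Prs)) Ret_NONTERM"
| safe_term:
    "\<lbrakk>safety_check X (Problem I T B) (SAFE Inv);
      \<not> (\<forall>s. holds Inv s \<longrightarrow> (\<exists>s'. holds2 T s s' \<and> holds Inv s'));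
      \<not> satisfiable (And I T)\<rbrakk>
     \<Longrightarrow> ext_step X (Running TrInv [Problem I T B]) Ret_TERM"
| safe_continue:
    "\<lbrakk>safety_check X (Problem I T B) (SAFE Inv);
      \<not> (\<forall>s. holds Inv s \<longrightarrow> (\<exists>s'. holds2 T s s' \<and> holds Inv s'));
      \<not> satisfiable (And I T);
      Prs \<noteq> []\<rbrakk>
     \<Longrightarrow> ext_step X (Running TrInv (Problem I T B # Prs)) (Running TrInv Prs)"
| safe_push:
    "\<lbrakk>safety_check X (Problem I T B) (SAFE Inv);
      \<not> (\<forall>s. holds Inv s \<longrightarrow> (\<exists>s'. holds2 T s s' \<and> holds Inv s'));
      satisfiable (And I T);
      qe (X \<times> {1}) T E\<rbrakk>
     \<Longrightarrow> ext_step X (Running TrInv (Problem I T B # Prs))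
                    (Running TrInv (Problem I T (Neg E) # Prs))"

abbreviation ext_run :: "'v::linorder set \<Rightarrow> 'v config \<Rightarrow> 'v config \<Rightarrow> bool" where
  "ext_run X \<equiv> (ext_step X)\<^sup>*\<^sup>*"

definition ext_start :: "'v cfm \<Rightarrow> 'v cfm \<Rightarrow> 'v cfm \<Rightarrow> 'v config" where
  "ext_start Init Tr Sink = Running FF [Problem Init Tr Sink]"

end

(* Every problem <I, T, B> on the stack satisfies T -> Tr, and every state of I is reachable from
   Init by Tr-steps: BlockTerm only strengthens I or T, and the formula S_m of the main loop
   describes states reached from I by m steps of T. When NONTERM is returned, a state of I lies
   in an invariant that is closed under taking some T-step, so it starts an infinite Tr-path, which
   is prefixed by the path from Init. *)

theory Submission
  imports Defs
begin

lemma tval_map_tm: "tval \<sigma> \<beta> (map_tm f t) = tval (\<sigma> \<circ> f) \<beta> t"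
  by (induction t) auto

lemma fval_map_fm: "fval \<sigma> \<beta> (map_fm f \<phi>) \<longleftrightarrow> fval (\<sigma> \<circ> f) \<beta> \<phi>"
  by (induction \<phi> arbitrary: \<beta>) (auto simp: tval_map_tm)

lemma sem_map_fm: "sem \<sigma> (map_fm f \<phi>) \<longleftrightarrow> sem (\<sigma> \<circ> f) \<phi>"
  by (simp add: sem_def fval_map_fm)

lemma tval_cong: "(\<And>v. v \<in> set_tm t \<Longrightarrow> \<sigma> v = \<tau> v) \<Longrightarrow> tval \<sigma> \<beta> t = tval \<tau> \<beta> t"
  by (induction t) auto

lemma fval_cong: "(\<And>v. v \<in> set_fm \<phi> \<Longrightarrow> \<sigma> v = \<tau> v) \<Longrightarrow> fval \<sigma> \<beta> \<phi> \<longleftrightarrow> fval \<tau> \<beta> \<phi>"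
proof (induction \<phi> arbitrary: \<beta>)
  case (Eq s t)
  then show ?case using tval_cong[of s \<sigma> \<tau> \<beta>] tval_cong[of t \<sigma> \<tau> \<beta>] by simp
next
  case (Le s t)
  then show ?case using tval_cong[of s \<sigma> \<tau> \<beta>] tval_cong[of t \<sigma> \<tau> \<beta>] by simp
next
  case (Dvd d t)
  then show ?case using tval_cong[of t \<sigma> \<tau> \<beta>] by simp
next
  case (And \<phi> \<psi>)
  then show ?case by (metis UnCI fm.set(7) fval.simps(7))
next
  case (Or \<phi> \<psi>)
  then show ?case by (metis UnCI fm.set(8) fval.simps(8))
qed simp_all

lemma sem_And: "sem \<sigma> (And \<phi> \<psi>) \<longleftrightarrow> sem \<sigma> \<phi> \<and> sem \<sigma> \<psi>"
  by (simp add: sem_def)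

lemma holds_And: "holds (And \<phi> \<psi>) s \<longleftrightarrow> holds \<phi> s \<and> holds \<psi> s"
  by (simp add: holds_def sem_And)

lemma holds2_And: "holds2 (And \<phi> \<psi>) s s' \<longleftrightarrow> holds2 \<phi> s s' \<and> holds2 \<psi> s s'"
  by (simp add: holds2_def sem_And)

text \<open>\<open>holds\<close> assigns the same state to every copy, so it cannot see a change of
  copy index.\<close>

lemma holds_at: "holds (at k \<phi>) s \<longleftrightarrow> holds \<phi> s"
  by (simp add: holds_def at_def sem_map_fm comp_def case_prod_beta')

lemma set_fm_at: "set_fm (at k \<phi>) \<subseteq> UNIV \<times> {k}"
  by (auto simp: at_def fm.set_map)

text \<open>Turns a valuation of many copies into a pair of states. \<open>between\<close> and
  \<open>holds2\<close> split the indices in the same way, zero against nonzero.\<close>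

lemma sem_between:
  "sem \<tau> (between k l \<phi>) \<longleftrightarrow> holds2 \<phi> (\<lambda>x. \<tau> (x, k)) (\<lambda>x. \<tau> (x, l))"
proof -
  have "\<tau> \<circ> (\<lambda>(x, j::nat). (x, if j = 0 then k else l)) =
        (\<lambda>(x, j). if j = 0 then \<tau> (x, k) else \<tau> (x, l))"
    by auto
  then show ?thesis
    by (simp only: between_def holds2_def sem_map_fm)
qed

text \<open>The copies of \<tau> may differ from each other, while \<open>holds\<close> makes them
  all equal; the two valuations are only known to agree at index 0.\<close>

lemma sem_state:
  assumes "set_fm \<phi> \<subseteq> UNIV \<times> {0}"
  shows "sem \<tau> \<phi> \<longleftrightarrow> holds \<phi> (\<lambda>x. \<tau> (x, 0))"
  unfolding holds_def sem_def using assms by (intro fval_cong) auto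

lemma sem_chain:
  assumes "sem \<tau> (chain T ks)" "Suc i < length ks"
  shows "sem \<tau> (between (ks ! i) (ks ! Suc i) T)"
  using assms
proof (induction T ks arbitrary: i rule: chain.induct)
  case (1 T k l ks)
  then show ?case by (cases i) (auto simp: sem_And)
qed auto

lemma sem_unroll:
  assumes "sem \<tau> (unroll T n)" "i < n"
  shows "holds2 T (\<lambda>x. \<tau> (x, i)) (\<lambda>x. \<tau> (x, Suc i))"
proof -
  have "sem \<tau> (between ([0..<Suc n] ! i) ([0..<Suc n] ! Suc i) T)"
    using assms by (intro sem_chain) (auto simp: unroll_def)
  then show ?thesis
    using assms(2) by (simp add: sem_between nth_append del: upt_Suc)
qed

text \<open>Steps are those of the original \<open>Tr\<close>, not of the current problem, so the
  notion is unaffected when \<open>BlockTerm\<close> strengthens \<open>T\<close>.\<close>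

definition reachable :: "'v cfm \<Rightarrow> 'v cfm \<Rightarrow> 'v state \<Rightarrow> bool" where
  "reachable Init Tr s \<longleftrightarrow> (\<exists>s0. holds Init s0 \<and> (holds2 Tr)\<^sup>*\<^sup>* s0 s)"

lemma reachable_path:
  assumes "reachable Init Tr (p 0)" "\<And>i. i < n \<Longrightarrow> holds2 Tr (p i) (p (Suc i))"
  shows "reachable Init Tr (p n)"
  using assms(2)
proof (induction n)
  case 0
  then show ?case using assms(1) by simp
next
  case (Suc n)
  then have "reachable Init Tr (p n)" "holds2 Tr (p n) (p (Suc n))" by auto
  then show ?case unfolding reachable_def by (meson rtranclp.rtrancl_into_rtrancl)
qed

(* Bounding the copy index in I suffices: whether the variables lie in X plays no role. *)
definition sound_problem :: "'v cfm \<Rightarrow> 'v cfm \<Rightarrow> 'v problem \<Rightarrow> bool" where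
  "sound_problem Init Tr P \<longleftrightarrow>
     set_fm (ini P) \<subseteq> UNIV \<times> {0} \<and>
     (\<forall>s s'. holds2 (tra P) s s' \<longrightarrow> holds2 Tr s s') \<and>
     (\<forall>s. holds (ini P) s \<longrightarrow> reachable Init Tr s)"

text \<open>Each exit of the loop adds a conjunct either to \<open>T\<close> or to \<open>I\<close>,
  and strengthening preserves soundness. Only \<open>S 0\<close> ever enters \<open>I\<close>, hence
  the index bound on it alone.\<close>

lemma sound_block_scan:
  assumes "sound_problem Init Tr (Problem I T B)" "set_fm (S 0) \<subseteq> UNIV \<times> {0}"
  shows "sound_problem Init Tr (block_scan (Problem I T B) S n)"
proof (induction n)
  case 0
  have "set_fm (And I (Neg (S 0))) \<subseteq> UNIV \<times> {0}"
    using assms by (simp add: sound_problem_def)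
  then show ?case
    using assms(1) by (simp add: sound_problem_def holds_And)
next
  case (Suc n)
  have "sound_problem Init Tr (Problem I (And T \<phi>) B)" for \<phi>
    using assms(1) by (simp add: sound_problem_def holds2_And)
  with Suc show ?case by simp
qed

lemma sound_block_term:
  assumes "sound_problem Init Tr (Problem I T B)" "block_term X (Problem I T B) n Q"
  shows "sound_problem Init Tr Q"
proof -
  obtain S where S: "\<forall>i\<le>n. \<exists>E. S i = at 0 E" and Q: "Q = block_scan (Problem I T B) S n"
    using assms(2) unfolding block_term_def by blast
  from S obtain E where "S 0 = at 0 E" by blast
  then have "set_fm (S 0) \<subseteq> UNIV \<times> {0}"
    by (simp only: set_fm_at)
  then show ?thesis
    unfolding Q by (rule sound_block_scan[OF assms(1)])
qed

text \<open>The valuation witnessing the eliminated quantifiers stores in its copies 0 to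
  \<open>m\<close> a \<open>T\<close>-path from a state of \<open>I\<close> to the given state. In
  the main loop \<psi> is \<open>Neg C\<close> over copy \<open>m\<close>.\<close>

lemma sound_image:
  assumes sound: "sound_problem Init Tr (Problem I T B)"
    and S: "qe (X \<times> {0..<m}) (And I (And (unroll T m) \<psi>)) S"
  shows "sound_problem Init Tr (Problem (at 0 S) T C)"
proof -
  have "reachable Init Tr s" if s: "holds (at 0 S) s" for s
  proof -
    let ?\<sigma> = "\<lambda>(x, k::nat). s x"
    have "sem ?\<sigma> S"
      using s[unfolded holds_at] by (simp only: holds_def)
    then have "\<exists>\<tau>. (\<forall>v. v \<notin> X \<times> {0..<m} \<longrightarrow> \<tau> v = ?\<sigma> v) \<and>
                   sem \<tau> (And I (And (unroll T m) \<psi>))"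
      using S by (simp only: qe_def)
    then obtain \<tau> where \<tau>: "\<And>v. v \<notin> X \<times> {0..<m} \<Longrightarrow> \<tau> v = ?\<sigma> v"
      and sem: "sem \<tau> I" "sem \<tau> (unroll T m)"
      unfolding sem_And by blast
    let ?p = "\<lambda>i x. \<tau> (x, i)"
    have "holds I (?p 0)"
      using sem(1) sound sem_state[of I \<tau>] by (simp add: sound_problem_def)
    then have "reachable Init Tr (?p 0)"
      using sound by (simp add: sound_problem_def)
    moreover have "holds2 Tr (?p i) (?p (Suc i))" if "i < m" for i
      using sem_unroll[OF sem(2) that] sound by (simp add: sound_problem_def)
    ultimately have "reachable Init Tr (?p m)"
      by (rule reachable_path)
    \<comment> \<open>Copy \<open>m\<close> lies outside the eliminated range
      \<open>{0..<m}\<close>, so \<tau> keeps the value of \<open>s\<close> there, both on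
      \<open>X\<close> and off it.\<close>
    moreover have "?p m x = s x" for x
      using \<tau>[of "(x, m)"] by simp
    ultimately show ?thesis by simp
  qed
  then show ?thesis
    using sound set_fm_at[of 0 S] by (simp add: sound_problem_def)
qed

fun sound_config :: "'v cfm \<Rightarrow> 'v cfm \<Rightarrow> 'v config \<Rightarrow> bool" where
  "sound_config Init Tr (Running TrInv Prs) \<longleftrightarrow> (\<forall>P\<in>set Prs. sound_problem Init Tr P)"
| "sound_config Init Tr _ \<longleftrightarrow> True"

text \<open>Only \<open>unsafe_unsafe\<close> creates problems with a new \<open>I\<close> or
  \<open>T\<close>. The other steps return, pop, or replace just \<open>B\<close>, and
  \<open>sound_problem\<close> constrains \<open>ini\<close> and \<open>tra\<close> only.\<close>

lemma sound_ext_step: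
  assumes "ext_step X c c'" "sound_config Init Tr c"
  shows "sound_config Init Tr c'"
  using assms
proof (induction rule: ext_step.induct)
  case (unsafe_unsafe I T B n TrInv TrInv' C m Q S Prs)
  then have "sound_problem Init Tr (Problem I T B)" by simp
  note sound_block_term[OF this unsafe_unsafe.hyps(4)] sound_image[OF this unsafe_unsafe.hyps(5)]
  then show ?case
    using unsafe_unsafe.prems by simp
qed (auto simp: sound_problem_def)

lemma sound_ext_run:
  assumes "ext_run X c c'" "sound_config Init Tr c"
  shows "sound_config Init Tr c'"
  using assms by induction (auto intro: sound_ext_step)

lemma rtranclp_then_infinite_path:
  assumes "r\<^sup>*\<^sup>* s0 s" "q 0 = s" "\<And>i. r (q i) (q (Suc i))"
  shows "\<exists>p. p 0 = s0 \<and> (\<forall>i. r (p i) (p (Suc i)))"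
  using assms(1)
proof (induction rule: converse_rtranclp_induct)
  case base
  then show ?case using assms(2,3) by blast
next
  case (step y z)
  then obtain p where p: "p 0 = z" "\<forall>i. r (p i) (p (Suc i))" by blast
  \<comment> \<open>\<open>case_nat y p\<close> is the sequence \<open>p\<close> shifted by one with
    \<open>y\<close> put in front.\<close>
  have "r (case_nat y p i) (case_nat y p (Suc i))" for i
    using step.hyps(1) p by (cases i) auto
  then show ?case
    by (intro exI[of _ "case_nat y p"]) simp
qed

text \<open>Dependent choice inside \<open>A\<close> yields an infinite path, to which the path from
  an initial state is prepended. The result serves every length \<open>n\<close> at once.\<close>

lemma nonterminating_if_closed:
  assumes "reachable Init Tr s" "A s" "\<And>s. A s \<Longrightarrow> \<exists>s'. holds2 Tr s s' \<and> A s'"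
  shows "nonterminating Init Tr"
proof -
  obtain s0 where s0: "holds Init s0" "(holds2 Tr)\<^sup>*\<^sup>* s0 s"
    using assms(1) unfolding reachable_def by blast
  have "\<exists>q. q 0 = s \<and> (\<forall>i. A (q i) \<and> holds2 Tr (q i) (q (Suc i)))"
    \<comment> \<open>The conjunct for \<open>n = 0\<close> forces the chosen sequence to start at
      \<open>s\<close>.\<close>
    using dependent_nat_choice[of "\<lambda>n t. A t \<and> (n = 0 \<longrightarrow> t = s)" "\<lambda>_. holds2 Tr"]
      assms(2,3) by auto
  then obtain q where "q 0 = s" "\<And>i. holds2 Tr (q i) (q (Suc i))" by blast
  then obtain p where "p 0 = s0" "\<forall>i. holds2 Tr (p i) (p (Suc i))"
    using rtranclp_then_infinite_path[OF s0(2)] by blast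
  then show ?thesis
    using s0(1) unfolding nonterminating_def by blast
qed

theorem lemma6:
  fixes X :: "'v::linorder set"
    and Init Tr Sink TrInv :: "('v \<times> nat) fm"
    and P :: "'v problem" and Prs :: "'v problem list"
  assumes "finite X"
    and "state_fm X Init" and "trans_fm X Tr" and "state_fm X Sink"
    and "\<forall>s. holds Sink s \<longleftrightarrow> \<not> (\<exists>s'. holds2 Tr s s')"
    and "ext_run X (ext_start Init Tr Sink) (Running TrInv (P # Prs))"
    and "ext_step X (Running TrInv (P # Prs)) Ret_NONTERM"
    and "\<exists>s. holds (ini P) s"
  shows "nonterminating Init Tr"
proof -
  have "sound_config Init Tr (ext_start Init Tr Sink)"
    using assms(2) by (auto simp: ext_start_def sound_problem_def reachable_def state_fm_def)
  then have sound: "sound_problem Init Tr P"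
    using sound_ext_run[OF assms(6)] by simp
  \<comment> \<open>\<open>safe_nonterm\<close> is the only rule that ends in
    \<open>Ret_NONTERM\<close>.\<close>
  obtain I T B Inv where P: "P = Problem I T B"
    and check: "safety_check X (Problem I T B) (SAFE Inv)"
    and closed: "\<forall>s. holds Inv s \<longrightarrow> (\<exists>s'. holds2 T s s' \<and> holds Inv s')"
    using assms(7) by (cases rule: ext_step.cases) auto
  \<comment> \<open>Satisfiability of \<open>I\<close> makes \<open>Inv\<close> nonempty, which
    rules out the vacuous invariant \<open>FF\<close>.\<close>
  obtain s where s: "holds I s"
    using assms(8) P by auto
  then have "holds Inv s"
    using check by (simp add: entails_def holds_def)
  moreover have "reachable Init Tr s"
    using sound s P by (simp add: sound_problem_def)
  \<comment> \<open>\<open>Inv\<close> is closed under taking some \<open>T\<close>-step, and by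
    soundness that step is also a \<open>Tr\<close>-step.\<close>
  moreover have "\<exists>s'. holds2 Tr s s' \<and> holds Inv s'" if "holds Inv s" for s
    using closed that sound by (simp add: P sound_problem_def) blast
  ultimately show ?thesis
    using nonterminating_if_closed[of Init Tr s "holds Inv"] by blast
qed

end
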